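(* Let $X$ be a nonempty compact Hausdorff space and let $A$ be a Banach algebra. If $C(X,A)$ is amenable, then $A$ is amenable.
   Context: Banach algebras are complex. $C(X,A)$ denotes the Banach algebra of all continuous functions $f: X\to A$ with pointwise algebraic operations and norm $\|f\|_\infty=\sup\{\|f(x)\|_A : x\in X\}$. A Banach algebra $B$ is amenable if every continuous derivation from $B$ into the dual bimodule $E^*$ of any Banach $B$-bimodule $E$ is inner. By a theorem of B. E. Johnson, this is equivalent to $B$ having a bounded approximate diagonal: a norm bounded net $(u_\alpha)$ in the projective tensor product $B\hat{\otimes}B$ with $a\cdot u_\alpha-u_\alpha\cdot a\to 0$ and $\pi(u_\alpha)a\to a$ in norm for all $a\in B$, where $a\cdot(b\otimes c)=ab\otimes c$, $(b\otimes c)\cdot a=b\otimes ca$, and $\pi: B\hat{\otimes}B\to B$ is the bounded linear map determined by $\pi(a\otimes b)=ab$. *)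

theory Defs
  imports "HOL-Analysis.Analysis"
begin

section \<open>Complex Banach algebras\<close>

class scaleC =
  fixes scaleC :: "complex \<Rightarrow> 'a \<Rightarrow> 'a"  (infixr \<open>*\<^sub>C\<close> 75)

class complex_banach = scaleC + banach +
  assumes scaleC_add_right: "c *\<^sub>C (x + y) = c *\<^sub>C x + c *\<^sub>C y"
    and scaleC_add_left: "(c + d) *\<^sub>C x = c *\<^sub>C x + d *\<^sub>C x"
    and scaleC_scaleC: "c *\<^sub>C (d *\<^sub>C x) = (c * d) *\<^sub>C x"
    and scaleC_of_real: "complex_of_real r *\<^sub>C x = r *\<^sub>R x"
    and norm_scaleC: "norm (c *\<^sub>C x) = cmod c * norm x"

text \<open>Banach algebras need not have a unit.\<close>

class complex_banach_algebra = complex_banach + real_normed_algebra +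
  assumes mult_scaleC_left: "(c *\<^sub>C x) * y = c *\<^sub>C (x * y)"
    and mult_scaleC_right: "x * (c *\<^sub>C y) = c *\<^sub>C (x * y)"

subsection \<open>The Banach algebra of continuous functions\<close>

text \<open>
  The type \<open>'x \<Rightarrow>\<^sub>C 'a\<close> consists of the bounded continuous functions with the supremum norm;
  for compact \<open>'x\<close> these are all continuous functions. The library proves
  completeness only for metric \<open>'x\<close>.
\<close>

lemma bcontfun_compact:
  fixes f :: "'x::topological_space \<Rightarrow> 'a::metric_space"
  assumes "compact (UNIV :: 'x set)"
  shows "f \<in> bcontfun \<longleftrightarrow> continuous_on UNIV f"
  using compact_continuous_image[OF _ assms, of f]
  by (auto simp: bcontfun_def intro: compact_imp_bounded)

lemma norm_bcontfun_eq_SUP: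
  fixes f :: "'x::topological_space \<Rightarrow>\<^sub>C 'a::real_normed_vector"
  shows "norm f = (SUP x. norm (apply_bcontfun f x))"
  by (simp add: norm_bcontfun_def dist_bcontfun.rep_eq)

instance bcontfun :: (topological_space, complete_space) complete_space
proof
  fix f :: "nat \<Rightarrow> ('a \<Rightarrow>\<^sub>C 'b)"
  assume "Cauchy f"
  then have "uniformly_convergent_on UNIV (\<lambda>n. apply_bcontfun (f n))"
    unfolding uniformly_convergent_eq_Cauchy uniformly_Cauchy_on_def Cauchy_def
    by (meson dist_fun_lt_imp_dist_val_lt)
  then obtain g where "uniform_limit UNIV (\<lambda>n. apply_bcontfun (f n)) g sequentially"
    by (auto simp: uniformly_convergent_on_def)
  then show "convergent f"
    by (metis uniform_limit_bcontfunE sequentially_bot convergentI)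
qed

instance bcontfun :: (topological_space, banach) banach ..

instantiation bcontfun :: (topological_space, complex_banach) complex_banach
begin

definition scaleC_bcontfun :: "complex \<Rightarrow> ('a \<Rightarrow>\<^sub>C 'b) \<Rightarrow> 'a \<Rightarrow>\<^sub>C 'b"
  where "scaleC_bcontfun c f = Bcontfun (\<lambda>x. c *\<^sub>C apply_bcontfun f x)"

lemma apply_bcontfun_scaleC:
  "apply_bcontfun (c *\<^sub>C f) x = c *\<^sub>C apply_bcontfun (f :: 'a \<Rightarrow>\<^sub>C 'b) x"
proof -
  have bl: "bounded_linear (\<lambda>x::'b. c *\<^sub>C x)"
  proof (rule bounded_linear_intro[where K = "cmod c"])
    fix r :: real and x :: 'b
    show "c *\<^sub>C (r *\<^sub>R x) = r *\<^sub>R (c *\<^sub>C x)"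
      by (simp flip: scaleC_of_real add: scaleC_scaleC mult.commute)
  qed (simp_all add: scaleC_add_right norm_scaleC mult.commute)
  have "continuous_on UNIV (\<lambda>x. c *\<^sub>C apply_bcontfun f x)"
    by (rule bounded_linear.continuous_on[OF bl]) simp
  moreover have "bounded (range (\<lambda>x. c *\<^sub>C apply_bcontfun f x))"
    using bounded_linear_image[OF _ bl, of "range (apply_bcontfun f)"] by (auto simp: image_image)
  ultimately show ?thesis
    by (simp add: scaleC_bcontfun_def bcontfun_def Bcontfun_inverse)
qed

instance
proof
  fix c d :: complex and r :: real and f g :: "'a \<Rightarrow>\<^sub>C 'b"
  show "c *\<^sub>C (f + g) = c *\<^sub>C f + c *\<^sub>C g"
    by (rule bcontfun_eqI) (simp add: apply_bcontfun_scaleC scaleC_add_right)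
  show "(c + d) *\<^sub>C f = c *\<^sub>C f + d *\<^sub>C f"
    by (rule bcontfun_eqI) (simp add: apply_bcontfun_scaleC scaleC_add_left)
  show "c *\<^sub>C (d *\<^sub>C f) = (c * d) *\<^sub>C f"
    by (rule bcontfun_eqI) (simp add: apply_bcontfun_scaleC scaleC_scaleC)
  show "complex_of_real r *\<^sub>C f = r *\<^sub>R f"
    by (rule bcontfun_eqI) (simp add: apply_bcontfun_scaleC scaleC_of_real)
  have le: "norm (c *\<^sub>C f) \<le> cmod c * norm f" for c and f :: "'a \<Rightarrow>\<^sub>C 'b"
    by (rule norm_bound)
      (simp add: apply_bcontfun_scaleC norm_scaleC norm_bounded mult_left_mono)
  show "norm (c *\<^sub>C f) = cmod c * norm f"
  proof (cases "c = 0")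
    case True
    then show ?thesis using le[of 0 f] by simp
  next
    case False
    have "inverse c *\<^sub>C (c *\<^sub>C f) = f"
    proof (rule bcontfun_eqI)
      fix x
      show "apply_bcontfun (inverse c *\<^sub>C (c *\<^sub>C f)) x = apply_bcontfun f x"
        using False scaleC_of_real[of 1 "apply_bcontfun f x"]
        by (simp add: apply_bcontfun_scaleC scaleC_scaleC)
    qed
    then have "norm f \<le> inverse (cmod c) * norm (c *\<^sub>C f)"
      using le[of "inverse c" "c *\<^sub>C f"] by (simp add: norm_inverse)
    then have "cmod c * norm f \<le> norm (c *\<^sub>C f)"
      using False by (simp add: field_simps)
    with le[of c f] show ?thesis by simp
  qed
qed

end

instantiation bcontfun :: (topological_space, complex_banach_algebra) complex_banach_algebra
begin

definition times_bcontfun :: "('a \<Rightarrow>\<^sub>C 'b) \<Rightarrow> ('a \<Rightarrow>\<^sub>C 'b) \<Rightarrow> 'a \<Rightarrow>\<^sub>C 'b"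
  where "times_bcontfun f g = Bcontfun (\<lambda>x. apply_bcontfun f x * apply_bcontfun g x)"

lemma apply_bcontfun_times:
  "apply_bcontfun (f * g) x = apply_bcontfun f x * apply_bcontfun (g :: 'a \<Rightarrow>\<^sub>C 'b) x"
proof -
  have "norm (apply_bcontfun f x * apply_bcontfun g x) \<le> norm f * norm g" for x
    by (rule order_trans[OF norm_mult_ineq]) (intro mult_mono norm_bounded norm_ge_zero)
  moreover have "continuous_on UNIV (\<lambda>x. apply_bcontfun f x * apply_bcontfun g x)"
    by (intro continuous_intros) auto
  ultimately have "(\<lambda>x. apply_bcontfun f x * apply_bcontfun g x) \<in> bcontfun"
    by (rule bcontfun_normI[rotated])
  then show ?thesis
    by (simp add: times_bcontfun_def Bcontfun_inverse)
qed

instance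
proof
  fix c :: complex and r :: real and f g h :: "'a \<Rightarrow>\<^sub>C 'b"
  show "f * g * h = f * (g * h)"
    by (rule bcontfun_eqI) (simp add: apply_bcontfun_times mult.assoc)
  show "(f + g) * h = f * h + g * h"
    by (rule bcontfun_eqI) (simp add: apply_bcontfun_times distrib_right)
  show "f * (g + h) = f * g + f * h"
    by (rule bcontfun_eqI) (simp add: apply_bcontfun_times distrib_left)
  show "(r *\<^sub>R f) * g = r *\<^sub>R (f * g)" "f * (r *\<^sub>R g) = r *\<^sub>R (f * g)"
    by (rule bcontfun_eqI, simp add: apply_bcontfun_times)+
  show "(c *\<^sub>C f) * g = c *\<^sub>C (f * g)" "f * (c *\<^sub>C g) = c *\<^sub>C (f * g)"
    by (rule bcontfun_eqI,
        simp add: apply_bcontfun_times apply_bcontfun_scaleC mult_scaleC_left mult_scaleC_right)+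
  show "norm (f * g) \<le> norm f * norm g"
    by (rule norm_bound, unfold apply_bcontfun_times, rule order_trans[OF norm_mult_ineq])
      (intro mult_mono norm_bounded norm_ge_zero)
qed

end


section \<open>Banach bimodules\<close>

record ('b, 'e) bimodule =
  mcarrier :: "'e set"
  mzero :: 'e
  mplus :: "'e \<Rightarrow> 'e \<Rightarrow> 'e"
  mscale :: "complex \<Rightarrow> 'e \<Rightarrow> 'e"
  mnorm :: "'e \<Rightarrow> real"
  lact :: "'b \<Rightarrow> 'e \<Rightarrow> 'e"
  ract :: "'e \<Rightarrow> 'b \<Rightarrow> 'e"

definition mminus :: "('b, 'e) bimodule \<Rightarrow> 'e \<Rightarrow> 'e \<Rightarrow> 'e"
  where "mminus E x y = mplus E x (mscale E (- 1) y)"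

text \<open>The axiom \<open>mscale_zero\<close> makes \<open>mscale E (- 1) x\<close> the additive inverse of \<open>x\<close>.\<close>

locale banach_bimodule =
  fixes E :: "('b::complex_banach_algebra, 'e) bimodule"
  assumes mzero_closed: "mzero E \<in> mcarrier E"
    and mplus_closed: "\<lbrakk>x \<in> mcarrier E; y \<in> mcarrier E\<rbrakk> \<Longrightarrow> mplus E x y \<in> mcarrier E"
    and mscale_closed: "x \<in> mcarrier E \<Longrightarrow> mscale E c x \<in> mcarrier E"
    and mplus_assoc: "\<lbrakk>x \<in> mcarrier E; y \<in> mcarrier E; z \<in> mcarrier E\<rbrakk>
      \<Longrightarrow> mplus E (mplus E x y) z = mplus E x (mplus E y z)"
    and mplus_commute: "\<lbrakk>x \<in> mcarrier E; y \<in> mcarrier E\<rbrakk> \<Longrightarrow> mplus E x y = mplus E y x"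
    and mplus_mzero: "x \<in> mcarrier E \<Longrightarrow> mplus E x (mzero E) = x"
    and mscale_zero: "x \<in> mcarrier E \<Longrightarrow> mscale E 0 x = mzero E"
    and mscale_one: "x \<in> mcarrier E \<Longrightarrow> mscale E 1 x = x"
    and mscale_mscale: "x \<in> mcarrier E \<Longrightarrow> mscale E c (mscale E d x) = mscale E (c * d) x"
    and mscale_add_left: "x \<in> mcarrier E
      \<Longrightarrow> mscale E (c + d) x = mplus E (mscale E c x) (mscale E d x)"
    and mscale_add_right: "\<lbrakk>x \<in> mcarrier E; y \<in> mcarrier E\<rbrakk>
      \<Longrightarrow> mscale E c (mplus E x y) = mplus E (mscale E c x) (mscale E c y)"
    and mnorm_eq_0: "x \<in> mcarrier E \<Longrightarrow> mnorm E x = 0 \<longleftrightarrow> x = mzero E"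
    and mnorm_triangle: "\<lbrakk>x \<in> mcarrier E; y \<in> mcarrier E\<rbrakk>
      \<Longrightarrow> mnorm E (mplus E x y) \<le> mnorm E x + mnorm E y"
    and mnorm_mscale: "x \<in> mcarrier E \<Longrightarrow> mnorm E (mscale E c x) = cmod c * mnorm E x"
    and complete: "\<lbrakk>\<And>n. \<sigma> n \<in> mcarrier E;
      \<And>e. e > 0 \<Longrightarrow> \<exists>N. \<forall>m\<ge>N. \<forall>n\<ge>N. mnorm E (mminus E (\<sigma> m) (\<sigma> n)) < e\<rbrakk>
      \<Longrightarrow> \<exists>x\<in>mcarrier E. (\<lambda>n. mnorm E (mminus E (\<sigma> n) x)) \<longlonglongrightarrow> 0"
    and lact_closed: "x \<in> mcarrier E \<Longrightarrow> lact E a x \<in> mcarrier E"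
    and lact_add_left: "x \<in> mcarrier E \<Longrightarrow> lact E (a + b) x = mplus E (lact E a x) (lact E b x)"
    and lact_scale_left: "x \<in> mcarrier E \<Longrightarrow> lact E (c *\<^sub>C a) x = mscale E c (lact E a x)"
    and lact_mplus: "\<lbrakk>x \<in> mcarrier E; y \<in> mcarrier E\<rbrakk>
      \<Longrightarrow> lact E a (mplus E x y) = mplus E (lact E a x) (lact E a y)"
    and lact_mscale: "x \<in> mcarrier E \<Longrightarrow> lact E a (mscale E c x) = mscale E c (lact E a x)"
    and lact_mult: "x \<in> mcarrier E \<Longrightarrow> lact E (a * b) x = lact E a (lact E b x)"
    and lact_bounded: "\<exists>M. \<forall>a. \<forall>x\<in>mcarrier E. mnorm E (lact E a x) \<le> M * norm a * mnorm E x"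
    and ract_closed: "x \<in> mcarrier E \<Longrightarrow> ract E x a \<in> mcarrier E"
    and ract_add_right: "x \<in> mcarrier E \<Longrightarrow> ract E x (a + b) = mplus E (ract E x a) (ract E x b)"
    and ract_scale_right: "x \<in> mcarrier E \<Longrightarrow> ract E x (c *\<^sub>C a) = mscale E c (ract E x a)"
    and ract_mplus: "\<lbrakk>x \<in> mcarrier E; y \<in> mcarrier E\<rbrakk>
      \<Longrightarrow> ract E (mplus E x y) a = mplus E (ract E x a) (ract E y a)"
    and ract_mscale: "x \<in> mcarrier E \<Longrightarrow> ract E (mscale E c x) a = mscale E c (ract E x a)"
    and ract_mult: "x \<in> mcarrier E \<Longrightarrow> ract E x (a * b) = ract E (ract E x a) b"
    and ract_bounded: "\<exists>M. \<forall>a. \<forall>x\<in>mcarrier E. mnorm E (ract E x a) \<le> M * norm a * mnorm E x"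
    and lact_ract: "x \<in> mcarrier E \<Longrightarrow> lact E a (ract E x b) = ract E (lact E a x) b"

text \<open>Functionals are taken to be \<^term>\<open>undefined\<close> outside the carrier, so that functionals
  agreeing on the carrier are equal.\<close>

definition dual_bimodule :: "('b, 'e) bimodule \<Rightarrow> ('b, 'e \<Rightarrow> complex) bimodule"
  where "dual_bimodule E =
   \<lparr> mcarrier = {f \<in> extensional (mcarrier E).
       (\<forall>x\<in>mcarrier E. \<forall>y\<in>mcarrier E. f (mplus E x y) = f x + f y) \<and>
       (\<forall>c. \<forall>x\<in>mcarrier E. f (mscale E c x) = c * f x) \<and>
       (\<exists>K. \<forall>x\<in>mcarrier E. cmod (f x) \<le> K * mnorm E x)},
     mzero = (\<lambda>x\<in>mcarrier E. 0),
     mplus = (\<lambda>f g. \<lambda>x\<in>mcarrier E. f x + g x),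
     mscale = (\<lambda>c f. \<lambda>x\<in>mcarrier E. c * f x),
     mnorm = (\<lambda>f. SUP x\<in>{x \<in> mcarrier E. mnorm E x \<le> 1}. cmod (f x)),
     lact = (\<lambda>a f. \<lambda>x\<in>mcarrier E. f (ract E x a)),
     ract = (\<lambda>f a. \<lambda>x\<in>mcarrier E. f (lact E a x)) \<rparr>"


section \<open>Amenability\<close>

definition continuous_derivation ::
  "('b::complex_banach_algebra, 'f) bimodule \<Rightarrow> ('b \<Rightarrow> 'f) \<Rightarrow> bool"
  where "continuous_derivation F D \<longleftrightarrow>
    (\<forall>a. D a \<in> mcarrier F) \<and>
    (\<forall>a b. D (a + b) = mplus F (D a) (D b)) \<and>
    (\<forall>c a. D (c *\<^sub>C a) = mscale F c (D a)) \<and>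
    (\<forall>a b. D (a * b) = mplus F (lact F a (D b)) (ract F (D a) b)) \<and>
    (\<exists>K. \<forall>a. mnorm F (D a) \<le> K * norm a)"

definition inner_derivation :: "('b, 'f) bimodule \<Rightarrow> ('b \<Rightarrow> 'f) \<Rightarrow> bool"
  where "inner_derivation F D \<longleftrightarrow>
    (\<exists>\<phi>\<in>mcarrier F. \<forall>a. D a = mminus F (lact F a \<phi>) (ract F \<phi> a))"

text \<open>
  Amenability quantifies over all Banach bimodules, but a HOL formula cannot quantify over the
  types carrying them. The following type of formal expressions (\<open>TLim\<close> denotes limits) is large enough to carry
  every countably generated Banach bimodule, and this suffices: the theorem
  \<open>amenable_imp_inner_derivation\<close> below extends the defining property of \<open>amenable\<close>
  to the Banach bimodules carried by an arbitrary type.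
\<close>

datatype 'b bimodule_term =
    TGen nat
  | TPlus "'b bimodule_term" "'b bimodule_term"
  | TScale complex "'b bimodule_term"
  | TLAct 'b "'b bimodule_term"
  | TRAct "'b bimodule_term" 'b
  | TLim "nat \<Rightarrow> 'b bimodule_term"

definition amenable :: "'b::complex_banach_algebra itself \<Rightarrow> bool"
  where "amenable (_ :: 'b itself) \<longleftrightarrow>
    (\<forall>(E :: ('b, 'b bimodule_term) bimodule) D.
      banach_bimodule E \<longrightarrow> continuous_derivation (dual_bimodule E) D \<longrightarrow>
      inner_derivation (dual_bimodule E) D)"

subsection \<open>Independence of the carrying type\<close>

text \<open>
  A derivation into \<open>dual_bimodule E\<close>, with \<open>E\<close> carried by any type, is inner on each closed
  sub-bimodule generated by a sequence \<open>s\<close>, since that sub-bimodule (\<open>range (teval s)\<close>) has a copy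
  carried by \<open>bimodule_term\<close>. The norms of the implementing functionals can be bounded
  independently of \<open>s\<close>, so Tychonoff's theorem yields a functional that works on all of \<open>E\<close>.
\<close>

context banach_bimodule
begin

lemma mnorm_nonneg:
  assumes "x \<in> mcarrier E" shows "0 \<le> mnorm E x"
proof -
  have "mplus E x (mscale E (- 1) x) = mzero E"
    using mscale_add_left[of x 1 "- 1"] assms by (simp add: mscale_zero mscale_one)
  then have "mnorm E (mzero E) \<le> mnorm E x + mnorm E (mscale E (- 1) x)"
    using mnorm_triangle[of x "mscale E (- 1) x"] assms by (simp add: mscale_closed)
  then show ?thesis
    using assms mnorm_eq_0[of "mzero E"] by (simp add: mnorm_mscale mzero_closed)
qed

definition implements :: "('b \<Rightarrow> 'e \<Rightarrow> complex) \<Rightarrow> 'e set \<Rightarrow> real \<Rightarrow> ('e \<Rightarrow> complex) \<Rightarrow> bool"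
  where "implements D S K \<psi> \<longleftrightarrow> (\<forall>x\<in>S. cmod (\<psi> x) \<le> K * mnorm E x \<and>
    (\<forall>y\<in>S. \<psi> (mplus E x y) = \<psi> x + \<psi> y) \<and> (\<forall>c. \<psi> (mscale E c x) = c * \<psi> x) \<and>
    (\<forall>b. D b x = \<psi> (ract E x b) - \<psi> (lact E b x)))"

primrec teval :: "(nat \<Rightarrow> 'e) \<Rightarrow> 'b bimodule_term \<Rightarrow> 'e" where
  "teval s (TGen n) = s n"
| "teval s (TPlus t u) = mplus E (teval s t) (teval s u)"
| "teval s (TScale c t) = mscale E c (teval s t)"
| "teval s (TLAct a t) = lact E a (teval s t)"
| "teval s (TRAct t a) = ract E (teval s t) a"
| "teval s (TLim f) =
    (if \<exists>x\<in>mcarrier E. (\<lambda>n. mnorm E (mminus E (teval s (f n)) x)) \<longlonglongrightarrow> 0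
     then SOME x. x \<in> mcarrier E \<and> (\<lambda>n. mnorm E (mminus E (teval s (f n)) x)) \<longlonglongrightarrow> 0
     else mzero E)"

lemma teval_Lim_cases:
  assumes "\<exists>x\<in>mcarrier E. (\<lambda>n. mnorm E (mminus E (teval s (f n)) x)) \<longlonglongrightarrow> 0"
  shows "teval s (TLim f) \<in> mcarrier E \<and>
    (\<lambda>n. mnorm E (mminus E (teval s (f n)) (teval s (TLim f)))) \<longlonglongrightarrow> 0"
proof -
  let ?P = "\<lambda>x. x \<in> mcarrier E \<and> (\<lambda>n. mnorm E (mminus E (teval s (f n)) x)) \<longlonglongrightarrow> 0"
  have "?P (SOME x. ?P x)"
    by (rule someI_ex) (use assms in blast)
  then show ?thesis
    using assms by simp
qed

context
  fixes s :: "nat \<Rightarrow> 'e"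
  assumes s: "\<And>n. s n \<in> mcarrier E"
begin

lemma teval_closed: "teval s t \<in> mcarrier E"
proof (induction t)
  case (TLim f)
  show ?case
  proof (cases "\<exists>x\<in>mcarrier E. (\<lambda>n. mnorm E (mminus E (teval s (f n)) x)) \<longlonglongrightarrow> 0")
    case True
    then show ?thesis using teval_Lim_cases by blast
  next
    case False
    then show ?thesis by (simp add: mzero_closed)
  qed
qed (simp_all add: s mplus_closed mscale_closed lact_closed ract_closed)

lemma range_teval_closed:
  "mzero E \<in> range (teval s)"
  "x \<in> range (teval s) \<Longrightarrow> y \<in> range (teval s) \<Longrightarrow> mplus E x y \<in> range (teval s)"
  "x \<in> range (teval s) \<Longrightarrow> mscale E c x \<in> range (teval s)"
  "x \<in> range (teval s) \<Longrightarrow> lact E a x \<in> range (teval s)"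
  "x \<in> range (teval s) \<Longrightarrow> ract E x a \<in> range (teval s)"
  "x \<in> range (teval s) \<Longrightarrow> x \<in> mcarrier E"
proof -
  show "mzero E \<in> range (teval s)"
    by (rule range_eqI[of _ _ "TScale 0 (TGen 0)"]) (simp add: mscale_zero s)
next
  assume "x \<in> range (teval s)" "y \<in> range (teval s)"
  then obtain t u where "x = teval s t" "y = teval s u" by blast
  then show "mplus E x y \<in> range (teval s)"
    by (intro range_eqI[of _ _ "TPlus t u"]) simp
next
  assume "x \<in> range (teval s)"
  then obtain t where t: "x = teval s t" by blast
  show "mscale E c x \<in> range (teval s)"
    by (rule range_eqI[of _ _ "TScale c t"]) (simp add: t)
  show "lact E a x \<in> range (teval s)"
    by (rule range_eqI[of _ _ "TLAct a t"]) (simp add: t)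
  show "ract E x a \<in> range (teval s)"
    by (rule range_eqI[of _ _ "TRAct t a"]) (simp add: t)
  show "x \<in> mcarrier E"
    by (simp add: t teval_closed)
qed

definition code :: "'e \<Rightarrow> 'b bimodule_term"
  where "code x = (SOME t. teval s t = x)"

lemma teval_code: "x \<in> range (teval s) \<Longrightarrow> teval s (code x) = x"
  unfolding code_def by (rule someI_ex) auto

definition coded :: "('b, 'b bimodule_term) bimodule"
  where "coded =
   \<lparr> mcarrier = code ` range (teval s),
     mzero = code (mzero E),
     mplus = (\<lambda>t u. code (mplus E (teval s t) (teval s u))),
     mscale = (\<lambda>c t. code (mscale E c (teval s t))),
     mnorm = (\<lambda>t. mnorm E (teval s t)),
     lact = (\<lambda>a t. code (lact E a (teval s t))),
     ract = (\<lambda>t a. code (ract E (teval s t) a)) \<rparr>"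

lemma coded_sel:
  "mcarrier coded = code ` range (teval s)"
  "mzero coded = code (mzero E)"
  "mplus coded t u = code (mplus E (teval s t) (teval s u))"
  "mscale coded c t = code (mscale E c (teval s t))"
  "mnorm coded t = mnorm E (teval s t)"
  "lact coded a t = code (lact E a (teval s t))"
  "ract coded t a = code (ract E (teval s t) a)"
  by (simp_all add: coded_def)

lemma code_eq_iff:
  "x \<in> range (teval s) \<Longrightarrow> y \<in> range (teval s) \<Longrightarrow> code x = code y \<longleftrightarrow> x = y"
  by (metis teval_code)

lemmas rc = range_teval_closed range_teval_closed(6)[OF rangeI]

lemma banach_bimodule_coded: "banach_bimodule coded"
proof (unfold_locales, goal_cases)
  case (15 \<sigma>)
  define \<tau> where "\<tau> n = teval s (\<sigma> n)" for n
  have \<tau>: "\<tau> n \<in> range (teval s)" for n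
    by (simp add: \<tau>_def)
  have eq: "mnorm coded (mminus coded (\<sigma> m) t) = mnorm E (mminus E (\<tau> m) (teval s t))" for m t
  proof -
    have "mscale E (- 1) (teval s t) \<in> range (teval s)"
      by (intro range_teval_closed rangeI)
    moreover from this have "mplus E (\<tau> m) (mscale E (- 1) (teval s t)) \<in> range (teval s)"
      by (intro range_teval_closed \<tau> rangeI)
    ultimately show ?thesis
      by (simp add: mminus_def coded_sel teval_code \<tau>_def)
  qed
  have "\<exists>x\<in>mcarrier E. (\<lambda>n. mnorm E (mminus E (\<tau> n) x)) \<longlonglongrightarrow> 0"
  proof (rule complete)
    show "\<tau> n \<in> mcarrier E" for n
      by (simp add: \<tau>_def teval_closed)
    show "\<exists>N. \<forall>m\<ge>N. \<forall>n\<ge>N. mnorm E (mminus E (\<tau> m) (\<tau> n)) < e" if "e > 0" for e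
      using 15(2)[OF that] unfolding eq \<tau>_def by simp
  qed
  then have "(\<lambda>n. mnorm E (mminus E (\<tau> n) (teval s (TLim \<sigma>)))) \<longlonglongrightarrow> 0"
    using teval_Lim_cases[of s \<sigma>] unfolding \<tau>_def by blast
  moreover have "teval s (code (teval s (TLim \<sigma>))) = teval s (TLim \<sigma>)"
    by (rule teval_code, rule rangeI)
  ultimately have "(\<lambda>n. mnorm coded (mminus coded (\<sigma> n) (code (teval s (TLim \<sigma>))))) \<longlonglongrightarrow> 0"
    unfolding eq by simp
  then show ?case
    by (intro bexI[of _ "code (teval s (TLim \<sigma>))"]) (simp_all only: coded_sel image_eqI rangeI)
next
  case 22
  obtain M where "\<forall>a. \<forall>x\<in>mcarrier E. mnorm E (lact E a x) \<le> M * norm a * mnorm E x"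
    using lact_bounded by blast
  then show ?case
    by (intro exI[of _ M]) (auto simp: coded_sel teval_code rc)
next
  case 29
  obtain M where "\<forall>a. \<forall>x\<in>mcarrier E. mnorm E (ract E x a) \<le> M * norm a * mnorm E x"
    using ract_bounded by blast
  then show ?case
    by (intro exI[of _ M]) (auto simp: coded_sel teval_code rc)
next
  case (5 x y) then show ?case
    by (auto simp: coded_sel teval_code rc mplus_commute)
next
  case (12 x) then show ?case
    by (auto simp: coded_sel teval_code rc code_eq_iff mnorm_eq_0)
next
  case (13 x y) then show ?case
    by (auto simp: coded_sel teval_code rc mnorm_triangle)
qed (auto simp: coded_sel teval_code rc mplus_assoc mplus_mzero mscale_zero mscale_one
    mscale_mscale mscale_add_left mscale_add_right mnorm_mscale lact_add_left lact_scale_left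
    lact_mplus lact_mscale lact_mult ract_add_right ract_scale_right ract_mplus ract_mscale
    ract_mult lact_ract)

lemma implements_range_eval:
  assumes am: "amenable TYPE('b)" and D: "continuous_derivation (dual_bimodule E) D"
  shows "\<exists>K \<psi>. implements D (range (teval s)) K \<psi>"
proof -
  interpret C: banach_bimodule coded
    by (rule banach_bimodule_coded)
  have Dlin: "D b (mplus E x y) = D b x + D b y" "D b (mscale E c x) = c * D b x"
    and Dbd: "\<exists>K. \<forall>x\<in>mcarrier E. cmod (D b x) \<le> K * mnorm E x"
    if "x \<in> mcarrier E" "y \<in> mcarrier E" for b c x y
    using D that by (auto simp: continuous_derivation_def dual_bimodule_def)
  have Dadd: "D (a + b) x = D a x + D b x"
    and Dscale: "D (c *\<^sub>C a) x = c * D a x"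
    and Dmult: "D (a * b) x = D b (ract E x a) + D a (lact E b x)"
    if "x \<in> mcarrier E" for a b c x
    using D that by (auto simp: continuous_derivation_def dual_bimodule_def)
  obtain K where K: "\<And>a. (SUP x\<in>{x \<in> mcarrier E. mnorm E x \<le> 1}. cmod (D a x)) \<le> K * norm a"
    using D by (auto simp: continuous_derivation_def dual_bimodule_def)
  define D' where "D' b = (\<lambda>t\<in>mcarrier coded. D b (teval s t))" for b
  have "continuous_derivation (dual_bimodule coded) D'"
    unfolding continuous_derivation_def
  proof (intro conjI allI)
    fix b
    obtain M where "\<forall>x\<in>mcarrier E. cmod (D b x) \<le> M * mnorm E x"
      using Dbd[OF mzero_closed mzero_closed] by blast
    then have "\<exists>M. \<forall>t\<in>mcarrier coded. cmod (D' b t) \<le> M * mnorm coded t"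
      by (intro exI[of _ M]) (simp add: D'_def coded_sel teval_closed)
    then show "D' b \<in> mcarrier (dual_bimodule coded)"
      using C.mplus_closed C.mscale_closed
      by (auto simp: dual_bimodule_def D'_def)
        (auto simp: coded_sel teval_code rc Dlin(1) Dlin(2)[OF _ mzero_closed])
  next
    fix a b
    show "D' (a + b) = mplus (dual_bimodule coded) (D' a) (D' b)"
      by (auto simp: D'_def dual_bimodule_def fun_eq_iff restrict_def Dadd teval_closed)
    show "D' (a * b) = mplus (dual_bimodule coded) (lact (dual_bimodule coded) a (D' b))
        (ract (dual_bimodule coded) (D' a) b)"
      using C.lact_closed C.ract_closed
      by (auto simp: D'_def dual_bimodule_def fun_eq_iff restrict_def)
        (auto simp: coded_sel teval_code rc Dmult teval_closed)
  next
    fix c a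
    show "D' (c *\<^sub>C a) = mscale (dual_bimodule coded) c (D' a)"
      by (auto simp: D'_def dual_bimodule_def fun_eq_iff restrict_def Dscale teval_closed)
  next
    have "mnorm (dual_bimodule coded) (D' a) \<le> K * norm a" for a
    proof (rule order_trans[OF _ K])
      obtain M where M: "\<And>x. x \<in> mcarrier E \<Longrightarrow> cmod (D a x) \<le> M * mnorm E x"
        using Dbd[OF mzero_closed mzero_closed] by blast
      have "bdd_above ((\<lambda>x. cmod (D a x)) ` {x \<in> mcarrier E. mnorm E x \<le> 1})"
      proof (rule bdd_aboveI2)
        fix x assume x: "x \<in> {x \<in> mcarrier E. mnorm E x \<le> 1}"
        then have "M * mnorm E x \<le> \<bar>M\<bar> * 1"
          using mnorm_nonneg[of x] by (intro mult_mono) auto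
        then show "cmod (D a x) \<le> \<bar>M\<bar>"
          using M[of x] x by simp
      qed
      moreover have "mzero coded \<in> {t \<in> mcarrier coded. mnorm coded t \<le> 1}"
        using C.mzero_closed C.mnorm_eq_0[of "mzero coded"] by simp
      moreover have "(\<lambda>t. cmod (D' a t)) ` {t \<in> mcarrier coded. mnorm coded t \<le> 1}
          \<subseteq> (\<lambda>x. cmod (D a x)) ` {x \<in> mcarrier E. mnorm E x \<le> 1}"
        by (auto simp: D'_def coded_sel teval_closed)
      ultimately show "mnorm (dual_bimodule coded) (D' a)
          \<le> (SUP x\<in>{x \<in> mcarrier E. mnorm E x \<le> 1}. cmod (D a x))"
        unfolding dual_bimodule_def by simp (rule cSup_subset_mono, auto)
    qed
    then show "\<exists>K. \<forall>a. mnorm (dual_bimodule coded) (D' a) \<le> K * norm a"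
      by blast
  qed
  with am C.banach_bimodule_axioms obtain \<phi> where
    \<phi>: "\<phi> \<in> mcarrier (dual_bimodule coded)" and
    D': "\<And>a. D' a = mminus (dual_bimodule coded) (lact (dual_bimodule coded) a \<phi>)
        (ract (dual_bimodule coded) \<phi> a)"
    unfolding amenable_def inner_derivation_def by blast
  have "\<exists>K. \<forall>t\<in>mcarrier coded. cmod (\<phi> t) \<le> K * mnorm coded t"
    using \<phi> by (simp add: dual_bimodule_def)
  then obtain K where K: "\<And>t. t \<in> mcarrier coded \<Longrightarrow> cmod (\<phi> t) \<le> K * mnorm coded t"
    by blast
  have \<phi>lin: "\<phi> (mplus coded t u) = \<phi> t + \<phi> u" "\<phi> (mscale coded c t) = c * \<phi> t"
    if "t \<in> mcarrier coded" "u \<in> mcarrier coded" for t u c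
    using \<phi> that by (auto simp: dual_bimodule_def)
  have D't: "D' a t = \<phi> (ract coded t a) - \<phi> (lact coded a t)" if "t \<in> mcarrier coded" for a t
    using that C.lact_closed C.ract_closed
    by (simp add: D' mminus_def) (simp add: dual_bimodule_def)
  have cc: "code x \<in> mcarrier coded" if "x \<in> range (teval s)" for x
    using that unfolding coded_sel by (rule imageI)
  have "implements D (range (teval s)) K (\<lambda>x. \<phi> (code x))"
    unfolding implements_def
  proof (intro ballI conjI allI)
    fix x assume x: "x \<in> range (teval s)"
    show "cmod (\<phi> (code x)) \<le> K * mnorm E x"
      using K[OF cc[OF x]] by (simp add: coded_sel teval_code x)
    show "\<phi> (code (mscale E c x)) = c * \<phi> (code x)" for c
      using \<phi>lin(2)[OF cc[OF x] cc[OF x]] by (simp add: coded_sel teval_code x)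
    show "D b x = \<phi> (code (ract E x b)) - \<phi> (code (lact E b x))" for b
      using D't[OF cc[OF x], of b] cc[OF x] by (simp add: coded_sel(5-) D'_def teval_code x)
    fix y assume y: "y \<in> range (teval s)"
    show "\<phi> (code (mplus E x y)) = \<phi> (code x) + \<phi> (code y)"
      using \<phi>lin(1)[OF cc[OF x] cc[OF y]] by (simp add: coded_sel teval_code x y)
  qed
  then show ?thesis by blast
qed

end

lemma range_teval_mono:
  assumes s: "\<And>n. s n \<in> mcarrier E" and u: "range u \<subseteq> range s"
  shows "range (teval u) \<subseteq> range (teval s)"
proof -
  note cl = range_teval_closed[of s, OF s]
  have "teval u t \<in> range (teval s)" for t
  proof (induction t)
    case (TGen n)
    obtain m where "u n = s m"
      using u by blast
    then show ?case
      by (intro range_eqI[of _ _ "TGen m"]) simp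
  next
    case (TLim f)
    then have "\<forall>n. \<exists>t. teval u (f n) = teval s t"
      by blast
    then obtain g where "\<And>n. teval u (f n) = teval s (g n)"
      by metis
    then have "teval u (TLim f) = teval s (TLim g)"
      by (simp only: teval.simps)
    then show ?case
      by (rule range_eqI)
  qed (simp_all only: teval.simps cl)
  then show ?thesis
    by blast
qed

lemma implements_mono:
  assumes "implements D S K \<psi>" "T \<subseteq> S" "T \<subseteq> mcarrier E" "K \<le> L"
  shows "implements D T L \<psi>"
proof -
  have "cmod (\<psi> x) \<le> L * mnorm E x" if "x \<in> T" for x
  proof -
    have "cmod (\<psi> x) \<le> K * mnorm E x"
      using assms(1,2) that unfolding implements_def by blast
    also have "\<dots> \<le> L * mnorm E x"
      using assms(3,4) that mnorm_nonneg[of x] by (intro mult_right_mono) auto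
    finally show ?thesis .
  qed
  moreover have "x \<in> S" if "x \<in> T" for x
    using assms(2) that by blast
  ultimately show ?thesis
    using assms(1) unfolding implements_def by blast
qed

lemma implements_uniform:
  assumes am: "amenable TYPE('b)" and D: "continuous_derivation (dual_bimodule E) D"
  shows "\<exists>K. \<forall>s. range s \<subseteq> mcarrier E \<longrightarrow> (\<exists>\<psi>. implements D (range (teval s)) K \<psi>)"
proof (rule ccontr)
  assume "\<not> ?thesis"
  then have "\<forall>k::nat. \<exists>s. range s \<subseteq> mcarrier E \<and> \<not> (\<exists>\<psi>. implements D (range (teval s)) (real k) \<psi>)"
    by blast
  then obtain s where s: "\<And>k. range (s k) \<subseteq> mcarrier E"
    and no: "\<And>k \<psi>. \<not> implements D (range (teval (s k))) (real k) \<psi>"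
    by metis
  define u where "u n = s (fst (prod_decode n)) (snd (prod_decode n))" for n
  have u: "u n \<in> mcarrier E" for n
    using s by (auto simp: u_def)
  obtain K \<psi> where *: "implements D (range (teval u)) K \<psi>"
    using implements_range_eval[of u, OF u am D] by blast
  obtain k :: nat where k: "K \<le> real k"
    using real_arch_simple by blast
  have "range (s k) \<subseteq> range u"
  proof safe
    fix m
    show "s k m \<in> range u"
      by (rule range_eqI[of _ _ "prod_encode (k, m)"]) (simp add: u_def)
  qed
  from range_teval_mono[OF u this] have "range (teval (s k)) \<subseteq> range (teval u)" .
  moreover have "range (teval (s k)) \<subseteq> mcarrier E"
    using s teval_closed[of "s k"] by blast
  ultimately show False
    using implements_mono[OF * _ _ k] no by blast
qed

lemma implements_mcarrier:
  assumes am: "amenable TYPE('b)" and D: "continuous_derivation (dual_bimodule E) D"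
  shows "\<exists>K \<psi>. implements D (mcarrier E) K \<psi>"
proof -
  from implements_uniform[OF am D]
  obtain K where K: "\<forall>s. range s \<subseteq> mcarrier E \<longrightarrow> (\<exists>\<psi>. implements D (range (teval s)) K \<psi>)" ..
  define P where "P = product_topology
    (\<lambda>x. subtopology (euclidean :: complex topology) (cball 0 (\<bar>K\<bar> * mnorm E x))) (mcarrier E)"
  define C where "C = (\<lambda>(x, y, c, b). {\<psi> \<in> topspace P. \<psi> (mplus E x y) - (\<psi> x + \<psi> y) = 0 \<and>
    \<psi> (mscale E c x) - c * \<psi> x = 0 \<and> \<psi> (ract E x b) - \<psi> (lact E b x) - D b x = 0})"
  define I :: "('e \<times> 'e \<times> complex \<times> 'b) set" where "I = mcarrier E \<times> mcarrier E \<times> UNIV"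
  have "compact_space P"
    unfolding P_def by (simp add: compact_space_product_topology compact_space_subtopology)
  have cont: "continuous_map P euclidean (\<lambda>\<psi>. \<psi> x)" if "x \<in> mcarrier E" for x
    using continuous_map_product_projection[OF that]
    unfolding P_def by (rule continuous_map_into_fulltopology)
  have closed0: "closedin P {\<psi> \<in> topspace P. f \<psi> = 0}"
    if "continuous_map P euclidean f" for f :: "_ \<Rightarrow> complex"
    using closedin_continuous_map_preimage[OF that, of "{0}"] by simp
  have closed: "closedin P (C i)" if i: "i \<in> I" for i
  proof -
    obtain x y c b where i': "i = (x, y, c, b)" and x: "x \<in> mcarrier E" and y: "y \<in> mcarrier E"
      using i by (auto simp: I_def)
    have "C i = {\<psi> \<in> topspace P. \<psi> (mplus E x y) - (\<psi> x + \<psi> y) = 0} \<inter>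
        {\<psi> \<in> topspace P. \<psi> (mscale E c x) - c * \<psi> x = 0} \<inter>
        {\<psi> \<in> topspace P. \<psi> (ract E x b) - \<psi> (lact E b x) - D b x = 0}"
      by (auto simp: C_def i')
    moreover have "continuous_map P euclidean (\<lambda>\<psi>. c * \<psi> x)"
      using continuous_map_compose[OF cont[OF x], of euclidean "\<lambda>z. c * z"]
      by (simp add: comp_def continuous_intros)
    ultimately show ?thesis
      by (auto simp only: intro!: closedin_Int closed0 continuous_map_diff continuous_map_add
          continuous_map_canonical_const cont mplus_closed mscale_closed lact_closed ract_closed x y)
  qed
  have fin: "topspace P \<inter> \<Inter> (C ` J) \<noteq> {}" if J: "finite J" "J \<subseteq> I" for J
  proof -
    define Z where "Z = insert (mzero E) (fst ` J \<union> (\<lambda>i. fst (snd i)) ` J)"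
    have "finite Z" "Z \<noteq> {}" "Z \<subseteq> mcarrier E"
      using J by (auto simp: Z_def I_def mzero_closed)
    then obtain s :: "nat \<Rightarrow> 'e" where s: "range s = Z"
      by (metis countable_finite range_from_nat_into)
    have sE: "s n \<in> mcarrier E" for n
      using s \<open>Z \<subseteq> mcarrier E\<close> by blast
    note cl = range_teval_closed[of s, OF sE]
    obtain \<psi> where \<psi>: "implements D (range (teval s)) K \<psi>"
      using K[rule_format, of s] s \<open>Z \<subseteq> mcarrier E\<close> by blast
    have ZF: "Z \<subseteq> range (teval s)"
    proof
      fix z assume "z \<in> Z"
      then obtain n where "z = s n" using s by blast
      then show "z \<in> range (teval s)"
        by (intro range_eqI[of _ _ "TGen n"]) simp
    qed
    define \<eta> where "\<eta> = (\<lambda>x\<in>mcarrier E. if x \<in> range (teval s) then \<psi> x else 0)"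
    have \<eta>: "\<eta> x = \<psi> x" if "x \<in> range (teval s)" for x
      using that cl(6) by (simp add: \<eta>_def)
    have "\<eta> \<in> topspace P"
    proof -
      have "cmod (\<eta> x) \<le> \<bar>K\<bar> * mnorm E x" if x: "x \<in> mcarrier E" for x
      proof (cases "x \<in> range (teval s)")
        case True
        then have "cmod (\<eta> x) \<le> K * mnorm E x"
          using bspec[OF \<psi>[unfolded implements_def] True] \<eta>[OF True] by simp
        also have "\<dots> \<le> \<bar>K\<bar> * mnorm E x"
          using mnorm_nonneg[OF x] by (intro mult_right_mono) auto
        finally show ?thesis .
      next
        case False
        then show ?thesis using mnorm_nonneg[OF x] x by (simp add: \<eta>_def)
      qed
      then show ?thesis
        by (auto simp: P_def PiE_iff \<eta>_def)
    qed
    moreover have "\<eta> \<in> C i" if i: "i \<in> J" for i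
    proof -
      obtain x y c b where i': "i = (x, y, c, b)" by (metis prod_cases4)
      have "x \<in> Z" "y \<in> Z"
        using i unfolding i' Z_def by force+
      then have xy: "x \<in> range (teval s)" "y \<in> range (teval s)"
        using ZF by blast+
      then have "\<psi> (mplus E x y) = \<psi> x + \<psi> y"
        using \<psi> unfolding implements_def by blast
      then show ?thesis
        using bspec[OF \<psi>[unfolded implements_def] xy(1)] \<open>\<eta> \<in> topspace P\<close>
        unfolding C_def i' by (simp add: \<eta> cl xy del: ball_simps)
    qed
    ultimately show ?thesis by blast
  qed
  have "topspace P \<inter> \<Inter> (C ` I) \<noteq> {}"
  proof -
    have I0: "(mzero E, mzero E, 0, 0) \<in> I"
      by (simp add: I_def mzero_closed)
    have "\<Inter> (C ` I) \<noteq> {}"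
    proof (rule \<open>compact_space P\<close>[unfolded compact_space_fip, rule_format], intro conjI ballI allI impI)
      show "closedin P S" if "S \<in> C ` I" for S
        using that closed by blast
      show "\<Inter> \<F> \<noteq> {}" if F: "finite \<F> \<and> \<F> \<subseteq> C ` I" for \<F>
      proof -
        obtain J where "finite J" "J \<subseteq> I" "\<F> = C ` J"
          using F finite_subset_image by metis
        then show ?thesis using fin by blast
      qed
    qed
    moreover have "\<Inter> (C ` I) \<subseteq> topspace P"
      using I0 by (auto simp: C_def)
    ultimately show ?thesis by blast
  qed
  then obtain \<psi> where \<psi>: "\<psi> \<in> topspace P" and \<psi>C: "\<And>i. i \<in> I \<Longrightarrow> \<psi> \<in> C i"
    by blast
  have "implements D (mcarrier E) \<bar>K\<bar> \<psi>"
    unfolding implements_def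
  proof (intro ballI conjI allI)
    fix x assume x: "x \<in> mcarrier E"
    show "cmod (\<psi> x) \<le> \<bar>K\<bar> * mnorm E x"
      using \<psi> x by (auto simp: P_def PiE_iff)
    show "\<psi> (mscale E c x) = c * \<psi> x" for c
      using \<psi>C[of "(x, x, c, 0)"] x by (simp add: C_def I_def)
    show "D b x = \<psi> (ract E x b) - \<psi> (lact E b x)" for b
      using \<psi>C[of "(x, x, 0, b)"] x by (simp add: C_def I_def)
    fix y assume y: "y \<in> mcarrier E"
    show "\<psi> (mplus E x y) = \<psi> x + \<psi> y"
      using \<psi>C[of "(x, y, 0, 0)"] x y by (simp add: C_def I_def)
  qed
  then show ?thesis by blast
qed

end

theorem amenable_imp_inner_derivation:
  fixes E :: "('b::complex_banach_algebra, 'e) bimodule"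
  assumes "amenable TYPE('b)" "banach_bimodule E" "continuous_derivation (dual_bimodule E) D"
  shows "inner_derivation (dual_bimodule E) D"
proof -
  interpret banach_bimodule E by fact
  obtain K \<psi> where \<psi>: "implements D (mcarrier E) K \<psi>"
    using implements_mcarrier[OF assms(1,3)] by blast
  define \<phi> where "\<phi> = restrict \<psi> (mcarrier E)"
  have "\<exists>K. \<forall>x\<in>mcarrier E. cmod (\<phi> x) \<le> K * mnorm E x"
    using \<psi> by (intro exI[of _ K]) (simp add: implements_def \<phi>_def)
  then have "\<phi> \<in> mcarrier (dual_bimodule E)"
    using \<psi> by (auto simp: implements_def dual_bimodule_def \<phi>_def mplus_closed mscale_closed)
  moreover have "D a = mminus (dual_bimodule E) (lact (dual_bimodule E) a \<phi>)
      (ract (dual_bimodule E) \<phi> a)" for a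
  proof
    fix x
    have "D a \<in> extensional (mcarrier E)"
      using assms(3) by (auto simp: continuous_derivation_def dual_bimodule_def)
    then show "D a x = mminus (dual_bimodule E) (lact (dual_bimodule E) a \<phi>)
        (ract (dual_bimodule E) \<phi> a) x"
      using \<psi> by (cases "x \<in> mcarrier E")
        (auto simp: implements_def mminus_def dual_bimodule_def \<phi>_def extensional_def
          lact_closed ract_closed)
  qed
  ultimately show ?thesis
    unfolding inner_derivation_def by blast
qed

end

theory Submission
  imports Defs
begin

text \<open>
  Evaluation at a point \<open>x\<^sub>0\<close> of \<open>X\<close> is a bounded homomorphism from \<open>C(X,A)\<close> to \<open>A\<close>, and the
  constant functions show that it is surjective. Hence the theorem is a case of the heredity of
  amenability under surjective bounded homomorphisms \<open>h : B \<rightarrow> A\<close>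
  (\<open>amenable_surj_hom\<close>). The latter holds because a Banach \<open>A\<close>-bimodule \<open>E\<close> becomes a Banach
  \<open>B\<close>-bimodule when \<open>B\<close> acts through \<open>h\<close> (\<open>banach_bimodule_pullback\<close>), and for a continuous
  derivation \<open>D : A \<rightarrow> E\<^sup>*\<close> the map \<open>D \<circ> h\<close> is then a continuous derivation from \<open>B\<close>. A functional
  that implements \<open>D \<circ> h\<close> implements \<open>D\<close> on the range of \<open>h\<close>, which is all of \<open>A\<close>.

  The pulled-back bimodule lives on the type of formal expressions over \<open>A\<close> rather than over \<open>B\<close>,
  so the amenability of \<open>B\<close> is used in the form \<open>amenable_imp_inner_derivation\<close>, for bimodules
  on arbitrary types.
\<close>

definition pullback :: "('b \<Rightarrow> 'a) \<Rightarrow> ('a, 'e) bimodule \<Rightarrow> ('b, 'e) bimodule"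
  where "pullback h E =
   \<lparr> mcarrier = mcarrier E, mzero = mzero E, mplus = mplus E, mscale = mscale E, mnorm = mnorm E,
     lact = (\<lambda>b. lact E (h b)), ract = (\<lambda>x b. ract E x (h b)) \<rparr>"

lemma pullback_sel [simp]:
  "mcarrier (pullback h E) = mcarrier E" "mzero (pullback h E) = mzero E"
  "mplus (pullback h E) = mplus E" "mscale (pullback h E) = mscale E"
  "mnorm (pullback h E) = mnorm E" "mminus (pullback h E) = mminus E"
  "lact (pullback h E) b = lact E (h b)" "ract (pullback h E) x b = ract E x (h b)"
  by (simp_all add: pullback_def mminus_def fun_eq_iff)

lemma dual_bimodule_pullback: "dual_bimodule (pullback h E) = pullback h (dual_bimodule E)"
  by (simp add: dual_bimodule_def pullback_def)

lemma banach_bimodule_pullback: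
  fixes h :: "'b::complex_banach_algebra \<Rightarrow> 'a::complex_banach_algebra"
  assumes E: "banach_bimodule E" and h: "bounded_linear h"
    and scaleC: "\<And>c b. h (c *\<^sub>C b) = c *\<^sub>C h b" and mult: "\<And>b b'. h (b * b') = h b * h b'"
  shows "banach_bimodule (pullback h E)"
proof -
  interpret banach_bimodule E by fact
  interpret h: bounded_linear h by fact
  obtain K where K: "K \<ge> 0" "\<And>b. norm (h b) \<le> norm b * K"
    using h.nonneg_bounded by blast
  have bound: "M * norm (h b) * mnorm E x \<le> (\<bar>M\<bar> * K) * norm b * mnorm E x"
    if "x \<in> mcarrier E" for M b x
  proof -
    have "M * norm (h b) \<le> \<bar>M\<bar> * (norm b * K)"
      by (rule mult_mono) (use K in auto)
    then show ?thesis
      using mnorm_nonneg[OF that] by (intro mult_right_mono) (simp_all add: mult_ac)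
  qed
  have lact_bounded': "\<exists>M. \<forall>b. \<forall>x\<in>mcarrier E. mnorm E (lact E (h b) x) \<le> M * norm b * mnorm E x"
    using lact_bounded bound by (meson order_trans)
  have ract_bounded': "\<exists>M. \<forall>b. \<forall>x\<in>mcarrier E. mnorm E (ract E x (h b)) \<le> M * norm b * mnorm E x"
    using ract_bounded bound by (meson order_trans)
  show ?thesis
    by (unfold_locales, use lact_bounded' ract_bounded' complete in \<open>simp_all add: h.add scaleC mult mzero_closed
        mplus_closed mscale_closed mplus_assoc mplus_mzero mscale_zero mscale_one mscale_mscale
        mscale_add_left mscale_add_right mnorm_eq_0 mnorm_triangle mnorm_mscale
        lact_closed lact_add_left lact_scale_left lact_mplus lact_mscale lact_mult
        ract_closed ract_add_right ract_scale_right ract_mplus ract_mscale ract_mult lact_ract\<close>)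
      (rule mplus_commute)
qed

lemma continuous_derivation_pullback:
  fixes h :: "'b::complex_banach_algebra \<Rightarrow> 'a::complex_banach_algebra"
  assumes D: "continuous_derivation F D" and h: "bounded_linear h"
    and scaleC: "\<And>c b. h (c *\<^sub>C b) = c *\<^sub>C h b" and mult: "\<And>b b'. h (b * b') = h b * h b'"
  shows "continuous_derivation (pullback h F) (\<lambda>b. D (h b))"
proof -
  interpret h: bounded_linear h by fact
  obtain L where L: "\<And>b. norm (h b) \<le> norm b * L"
    using h.bounded by blast
  obtain K where K: "\<And>a. mnorm F (D a) \<le> K * norm a"
    using D unfolding continuous_derivation_def by blast
  have "mnorm F (D (h b)) \<le> (\<bar>K\<bar> * L) * norm b" for b
  proof -
    have "mnorm F (D (h b)) \<le> \<bar>K\<bar> * norm (h b)"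
      using K[of "h b"] by (rule order_trans) (simp add: mult_right_mono)
    also have "\<dots> \<le> \<bar>K\<bar> * (norm b * L)"
      using L by (simp add: mult_left_mono)
    finally show ?thesis by (simp add: mult_ac)
  qed
  then have "\<exists>K. \<forall>b. mnorm F (D (h b)) \<le> K * norm b"
    by blast
  then show ?thesis
    using D unfolding continuous_derivation_def by (simp add: h.add scaleC mult)
qed

theorem amenable_surj_hom:
  fixes h :: "'b::complex_banach_algebra \<Rightarrow> 'a::complex_banach_algebra"
  assumes am: "amenable TYPE('b)" and h: "bounded_linear h"
    and scaleC: "\<And>c b. h (c *\<^sub>C b) = c *\<^sub>C h b" and mult: "\<And>b b'. h (b * b') = h b * h b'"
    and surj: "surj h"
  shows "amenable TYPE('a)"
  unfolding amenable_def
proof (intro allI impI)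
  fix E :: "('a, 'a bimodule_term) bimodule" and D
  assume E: "banach_bimodule E" and D: "continuous_derivation (dual_bimodule E) D"
  have "inner_derivation (dual_bimodule (pullback h E)) (\<lambda>b. D (h b))"
    using am banach_bimodule_pullback[OF E h scaleC mult]
      continuous_derivation_pullback[OF D h scaleC mult]
    unfolding dual_bimodule_pullback[symmetric] by (rule amenable_imp_inner_derivation)
  then obtain \<phi> where "\<phi> \<in> mcarrier (dual_bimodule E)"
    and \<phi>: "\<And>b. D (h b) =
      mminus (dual_bimodule E) (lact (dual_bimodule E) (h b) \<phi>) (ract (dual_bimodule E) \<phi> (h b))"
    unfolding inner_derivation_def dual_bimodule_pullback by auto
  moreover have "D a =
      mminus (dual_bimodule E) (lact (dual_bimodule E) a \<phi>) (ract (dual_bimodule E) \<phi> a)" for a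
    using \<phi> surjD[OF surj, of a] by blast
  ultimately show "inner_derivation (dual_bimodule E) D"
    unfolding inner_derivation_def by blast
qed

theorem mainTheorem3:
  assumes "compact (UNIV :: 'x::t2_space set)"
    and "amenable TYPE('x \<Rightarrow>\<^sub>C 'a::complex_banach_algebra)"
  shows "amenable TYPE('a)"
proof (rule amenable_surj_hom[OF assms(2)])
  \<comment> \<open>The point of evaluation is arbitrary; \<open>undefined\<close> serves because types are nonempty.\<close>
  let ?ev = "\<lambda>f :: 'x \<Rightarrow>\<^sub>C 'a. apply_bcontfun f undefined"
  show "bounded_linear ?ev"
    by (rule bounded_linear_intro[where K = 1]) (simp_all add: norm_bounded)
  show "?ev (c *\<^sub>C f) = c *\<^sub>C ?ev f" for c f
    by (rule apply_bcontfun_scaleC)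
  show "?ev (f * g) = ?ev f * ?ev g" for f g
    by (rule apply_bcontfun_times)
  show "surj ?ev"
    by (rule surjI[where f = const_bcontfun]) simp
qed

end
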